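(* Let $\mathcal{A}$ be an independence algebra with universe $A$, let $\mathcal{B}$ be a non-empty subalgebra of $\mathcal{A}$ with universe $B$, and let $T(\mathcal{A},\mathcal{B})$ be the semigroup of all endomorphisms of $\mathcal{A}$ whose image is contained in $B$. Then $T(\mathcal{A},\mathcal{B})$ is isomorphic to the endomorphism monoid $\mathrm{End}(\mathcal{C})$ of some independence algebra $\mathcal{C}$ if and only if $\mathcal{B}=\mathcal{A}$ or $\mathcal{B}$ is a singleton.
   Context: An algebra $\mathcal{A}=\langle A;F\rangle$ has a non-empty universe $A$ and a set $F$ of finitary operations. For $X\subseteq A$, $\langle X\rangle$ is the set of all $t(a_1,\dots,a_n)$ with $t$ a term operation and $a_i\in X$ (the subalgebra generated by $X$); $\langle\emptyset\rangle$ is the set of constants, i.e. values of nullary term operations (possibly empty). $X$ is independent if $x\notin\langle X\setminus\{x\}\rangle$ for all $x\in X$; a basis of a subalgebra is an independent generating set. Exchange property (EP): for all $X\subseteq A$ and $a,b\in A$, if $b\in\langle X\cup\{a\}\rangle$ and $b\notin\langle X\rangle$ then $a\in\langle X\cup\{b\}\rangle$. Under (EP) every subalgebra has a basis, all its bases have the same cardinality, and independent sets extend to bases. Free basis property (F): every map from a basis of $\mathcal{A}$ to $A$ extends to an endomorphism of $\mathcal{A}$. An independence algebra is an algebra satisfying (EP) and (F). Semigroup operations are composition of maps, and isomorphism means isomorphism of semigroups. *)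

theory Defs
  imports Main "HOL-Library.FuncSet"
begin

text \<open>
  An operation is a pair \<open>(n, f)\<close>, where \<open>f\<close> is only meaningful on lists of length \<open>n\<close> over the
  universe. Different algebras may have unrelated sets of operations (no signature is fixed).
\<close>

record 'a ualgebra =
  universe :: "'a set"
  operations :: "(nat \<times> ('a list \<Rightarrow> 'a)) set"

definition closed_under_ops :: "'a ualgebra \<Rightarrow> 'a set \<Rightarrow> bool" where
  "closed_under_ops \<A> B \<longleftrightarrow>
     (\<forall>(n, f) \<in> operations \<A>. \<forall>xs. length xs = n \<and> set xs \<subseteq> B \<longrightarrow> f xs \<in> B)"

definition is_ualgebra :: "'a ualgebra \<Rightarrow> bool" where
  "is_ualgebra \<A> \<longleftrightarrow> universe \<A> \<noteq> {} \<and> closed_under_ops \<A> (universe \<A>)"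

text \<open>
  Universes of subalgebras. The empty set is allowed if there are no nullary operations.
\<close>

definition subuniverse :: "'a ualgebra \<Rightarrow> 'a set \<Rightarrow> bool" where
  "subuniverse \<A> B \<longleftrightarrow> B \<subseteq> universe \<A> \<and> closed_under_ops \<A> B"

inductive term_op :: "'a ualgebra \<Rightarrow> nat \<Rightarrow> ('a list \<Rightarrow> 'a) \<Rightarrow> bool"
  for \<A> :: "'a ualgebra" and n :: nat where
  proj: "i < n \<Longrightarrow> term_op \<A> n (\<lambda>xs. xs ! i)"
| comp: "(m, f) \<in> operations \<A> \<Longrightarrow> length gs = m \<Longrightarrow> \<forall>g \<in> set gs. term_op \<A> n g
         \<Longrightarrow> term_op \<A> n (\<lambda>xs. f (map (\<lambda>g. g xs) gs))"

text \<open>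
  The arity \<open>n = 0\<close> is included, so \<open>generated \<A> {}\<close> is exactly the set of values of nullary term
  operations; it is empty if \<open>\<A>\<close> has no nullary operations, even if some term operation
  of positive arity is a constant function.
\<close>

definition generated :: "'a ualgebra \<Rightarrow> 'a set \<Rightarrow> 'a set" where
  "generated \<A> X = {t xs | n t xs. term_op \<A> n t \<and> length xs = n \<and> set xs \<subseteq> X}"

definition independent :: "'a ualgebra \<Rightarrow> 'a set \<Rightarrow> bool" where
  "independent \<A> X \<longleftrightarrow> X \<subseteq> universe \<A> \<and> (\<forall>x \<in> X. x \<notin> generated \<A> (X - {x}))"

definition basis_of :: "'a ualgebra \<Rightarrow> 'a set \<Rightarrow> 'a set \<Rightarrow> bool" where
  "basis_of \<A> B X \<longleftrightarrow> independent \<A> X \<and> generated \<A> X = B"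

text \<open>
  Endomorphisms are maps on the universe, represented extensionally so that equality of
  functions is equality of maps.
\<close>

definition End :: "'a ualgebra \<Rightarrow> ('a \<Rightarrow> 'a) set" where
  "End \<A> = {h \<in> universe \<A> \<rightarrow>\<^sub>E universe \<A>.
     \<forall>(n, f) \<in> operations \<A>. \<forall>xs. length xs = n \<and> set xs \<subseteq> universe \<A> \<longrightarrow>
       h (f xs) = f (map h xs)}"

definition exchange_property :: "'a ualgebra \<Rightarrow> bool" where
  "exchange_property \<A> \<longleftrightarrow>
     (\<forall>X a b. X \<subseteq> universe \<A> \<and> a \<in> universe \<A> \<and> b \<in> universe \<A> \<and>
        b \<in> generated \<A> (X \<union> {a}) \<and> b \<notin> generated \<A> X \<longrightarrow>
        a \<in> generated \<A> (X \<union> {b}))"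

definition free_basis_property :: "'a ualgebra \<Rightarrow> bool" where
  "free_basis_property \<A> \<longleftrightarrow>
     (\<forall>X \<phi>. basis_of \<A> (universe \<A>) X \<and> \<phi> \<in> X \<rightarrow> universe \<A> \<longrightarrow>
        (\<exists>h \<in> End \<A>. \<forall>x \<in> X. h x = \<phi> x))"

definition independence_algebra :: "'a ualgebra \<Rightarrow> bool" where
  "independence_algebra \<A> \<longleftrightarrow>
     is_ualgebra \<A> \<and> exchange_property \<A> \<and> free_basis_property \<A>"

definition End_into :: "'a ualgebra \<Rightarrow> 'a set \<Rightarrow> ('a \<Rightarrow> 'a) set" where
  "End_into \<A> B = {h \<in> End \<A>. h ` universe \<A> \<subseteq> B}"

text \<open>
  Stated for bare carriers and products, since a semigroup such as \<open>End_into \<A> B\<close> need not have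
  the identity element that is a field of the monoid records of \<open>HOL-Algebra\<close>.
\<close>

definition semigroup_isomorphic ::
  "'s set \<Rightarrow> ('s \<Rightarrow> 's \<Rightarrow> 's) \<Rightarrow> 't set \<Rightarrow> ('t \<Rightarrow> 't \<Rightarrow> 't) \<Rightarrow> bool" where
  "semigroup_isomorphic S mult\<^sub>S T mult\<^sub>T \<longleftrightarrow>
     (\<exists>\<Phi>. bij_betw \<Phi> S T \<and> (\<forall>x \<in> S. \<forall>y \<in> S. \<Phi> (mult\<^sub>S x y) = mult\<^sub>T (\<Phi> x) (\<Phi> y)))"

text \<open>
  \<open>\<C>\<close> may live on a different type than \<open>\<A>\<close>.
\<close>

definition End_into_iso_End :: "'a ualgebra \<Rightarrow> 'a set \<Rightarrow> 'c ualgebra \<Rightarrow> bool" where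
  "End_into_iso_End \<A> B \<C> \<longleftrightarrow>
     semigroup_isomorphic (End_into \<A> B) (compose (universe \<A>)) (End \<C>) (compose (universe \<C>))"

end

theory Submission
  imports Defs
begin

text \<open>
  Only the identity of \<open>End \<C>\<close> is needed: an isomorphism makes \<open>T(\<A>, \<B>)\<close> a monoid, with identity
  \<open>e\<close> say. If \<open>x\<close> lies outside \<open>\<B>\<close>, a basis \<open>Y\<close> of \<open>\<B>\<close> extends to a basis of \<open>\<A>\<close> containing
  \<open>x\<close>, so there are maps in \<open>T(\<A>, \<B>)\<close> which agree on \<open>Y\<close> and take arbitrary values
  \<open>b, c\<close> of \<open>\<B>\<close> at \<open>x\<close>. They agree at \<open>e x\<close>, which lies in \<open>\<B> = \<langle>Y\<rangle>\<close>, and hence also at \<open>x\<close>,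
  because \<open>h \<circ> e = h\<close>; so \<open>b = c\<close>.
\<close>

section \<open>Term operations and generated subalgebras\<close>

lemma closed_under_opsD:
  assumes "closed_under_ops \<A> B" "(n, f) \<in> operations \<A>" "length xs = n" "set xs \<subseteq> B"
  shows "f xs \<in> B"
  using assms unfolding closed_under_ops_def by blast

lemma generatedI:
  assumes "term_op \<A> n t" "length xs = n" "set xs \<subseteq> X"
  shows "t xs \<in> generated \<A> X"
  using assms unfolding generated_def by blast

lemma generatedE:
  assumes "y \<in> generated \<A> X"
  obtains n t xs where "term_op \<A> n t" "length xs = n" "set xs \<subseteq> X" "y = t xs"
  using assms unfolding generated_def by blast

lemma generated_mono: "X \<subseteq> Y \<Longrightarrow> generated \<A> X \<subseteq> generated \<A> Y"
  unfolding generated_def by blast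

lemma generated_superset: "X \<subseteq> generated \<A> X"
proof
  fix x assume "x \<in> X"
  then show "x \<in> generated \<A> X"
    using generatedI[OF term_op.proj[of 0 1 \<A>], of "[x]" X] by simp
qed

lemma term_op_in_closed:
  assumes "term_op \<A> n t" "closed_under_ops \<A> S" "length xs = n" "set xs \<subseteq> S"
  shows "t xs \<in> S"
  using assms(1)
proof induction
  case (proj i)
  then show ?case using assms(3,4) by auto
next
  case (comp m f gs)
  then show ?case by (intro closed_under_opsD[OF assms(2) comp(1)]) auto
qed

text \<open>Serves as an induction principle for \<open>generated\<close>: to carry a property from
  \<open>X\<close> to everything it generates, take for \<open>S\<close> the points having that
  property.\<close>

lemma generated_subset_closed:
  assumes "X \<subseteq> S" "closed_under_ops \<A> S"
  shows "generated \<A> X \<subseteq> S"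
  using assms by (blast elim: generatedE intro: term_op_in_closed)

text \<open>Terms witnessing membership in \<open>generated\<close> come with different arities and
  argument lists, whereas \<open>term_op.comp\<close> needs one common arity. Replacing each
  projection by a position in \<open>ys\<close> where the same entry occurs moves a term to the list
  \<open>ys\<close>; agreement at this one argument list is enough.\<close>

lemma term_op_reindex:
  assumes "term_op \<A> n t" "length xs = n" "set xs \<subseteq> set ys"
  shows "\<exists>t'. term_op \<A> (length ys) t' \<and> t' ys = t xs"
  using assms(1)
proof induction
  case (proj i)
  then have "xs ! i \<in> set ys" using assms(2,3) by auto
  then obtain j where "j < length ys" "ys ! j = xs ! i" by (auto simp: in_set_conv_nth)
  then show ?case using term_op.proj by blast
next
  case (comp m f gs)
  then obtain G where G: "\<And>g. g \<in> set gs \<Longrightarrow> term_op \<A> (length ys) (G g) \<and> G g ys = g xs"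
    by metis
  have "term_op \<A> (length ys) (\<lambda>zs. f (map (\<lambda>g. g zs) (map G gs)))"
    using G comp(1,2) by (intro term_op.comp[of m]) auto
  moreover have "f (map (\<lambda>g. g ys) (map G gs)) = f (map (\<lambda>g. g xs) gs)"
    using G by (auto intro!: arg_cong[of _ _ f])
  ultimately show ?case by blast
qed

lemma closed_generated: "closed_under_ops \<A> (generated \<A> X)"
  unfolding closed_under_ops_def
proof clarify
  fix f and zs :: "'a list"
  assume f: "(length zs, f) \<in> operations \<A>" and zs: "set zs \<subseteq> generated \<A> X"
  have "\<exists>n t xs. term_op \<A> n t \<and> length xs = n \<and> set xs \<subseteq> X \<and> z = t xs" if "z \<in> set zs" for z
    using that zs by (meson generatedE subsetD)
  then obtain N T XS where
    *: "\<And>z. z \<in> set zs \<Longrightarrow>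
      term_op \<A> (N z) (T z) \<and> length (XS z) = N z \<and> set (XS z) \<subseteq> X \<and> z = T z (XS z)"
    by metis
  \<comment> \<open>One argument list that serves the terms of all entries of \<open>zs\<close> at
    once.\<close>
  define ys where "ys = concat (map XS zs)"
  have "\<exists>t'. term_op \<A> (length ys) t' \<and> t' ys = z" if "z \<in> set zs" for z
    using term_op_reindex[of \<A> "N z" "T z" "XS z" ys] *[OF that] that by (force simp: ys_def)
  then obtain G where G: "\<And>z. z \<in> set zs \<Longrightarrow> term_op \<A> (length ys) (G z) \<and> G z ys = z"
    by metis
  have "term_op \<A> (length ys) (\<lambda>us. f (map (\<lambda>g. g us) (map G zs)))"
    using f G by (intro term_op.comp[of "length zs"]) auto
  moreover have "map (\<lambda>g. g ys) (map G zs) = zs"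
    using G by (simp add: map_idI)
  moreover have "set ys \<subseteq> X" using * by (fastforce simp: ys_def)
  ultimately show "f zs \<in> generated \<A> X"
    using generatedI[of \<A> "length ys" _ ys X] by fastforce
qed

section \<open>Extending independent sets by exchange and Zorn's lemma\<close>

lemma generated_chain_Union:
  assumes "subset.chain \<X> C" "C \<noteq> {}" "x \<in> generated \<A> (\<Union>C)"
  obtains c where "c \<in> C" "x \<in> generated \<A> c"
proof -
  obtain n t xs where t: "term_op \<A> n t" "length xs = n" "set xs \<subseteq> \<Union>C" "x = t xs"
    using assms(3) by (rule generatedE)
  \<comment> \<open>A term has only finitely many arguments, so a single member of the chain
    contains them all.\<close>
  obtain c where "c \<in> C" "set xs \<subseteq> c"
    using finite_subset_Union_chain[OF _ t(3) assms(2,1)] by blast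
  then show thesis using that t generatedI by metis
qed

text \<open>If some \<open>y\<close> in \<open>J\<close> became dependent after adding
  \<open>x\<close>, then, as \<open>y\<close> is not generated by \<open>J - {y}\<close>, exchange
  would put \<open>x\<close> into the subalgebra generated by \<open>J\<close>.\<close>

lemma independent_insert:
  assumes "exchange_property \<A>" "independent \<A> J" "x \<in> universe \<A>" "x \<notin> generated \<A> J"
  shows "independent \<A> (insert x J)"
  unfolding independent_def
proof (intro conjI ballI)
  show "insert x J \<subseteq> universe \<A>" using assms unfolding independent_def by auto
  fix y assume y: "y \<in> insert x J"
  show "y \<notin> generated \<A> (insert x J - {y})"
  proof (cases "y = x")
    case True
    then show ?thesis using assms(4) generated_mono[of "insert x J - {x}" J \<A>] by auto
  next
    case False
    then have yJ: "y \<in> J" using y by simp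
    have J: "J \<subseteq> universe \<A>" "y \<notin> generated \<A> (J - {y})"
      using assms(2) yJ unfolding independent_def by auto
    have "insert x J - {y} = (J - {y}) \<union> {x}" "(J - {y}) \<union> {y} = J" using False yJ by auto
    moreover have "x \<in> generated \<A> ((J - {y}) \<union> {y})"
      if "y \<in> generated \<A> ((J - {y}) \<union> {x})"
    proof -
      have "J - {y} \<subseteq> universe \<A>" "y \<in> universe \<A>" using J(1) yJ by auto
      then show ?thesis
        using assms(1,3) J(2) that unfolding exchange_property_def by blast
    qed
    ultimately show ?thesis using assms(4) by metis
  qed
qed

text \<open>By Zorn there is a maximal independent set between \<open>I\<close> and
  \<open>S\<close>; a point of \<open>S\<close> that it does not generate could be added by
  \<open>independent_insert\<close>. With \<open>S\<close> a subuniverse this yields bases of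
  it.\<close>

lemma independent_extend:
  assumes "exchange_property \<A>" "independent \<A> I" "I \<subseteq> S" "S \<subseteq> universe \<A>"
  obtains J where "I \<subseteq> J" "J \<subseteq> S" "independent \<A> J" "S \<subseteq> generated \<A> J"
proof -
  define \<X> where "\<X> = {J. I \<subseteq> J \<and> J \<subseteq> S \<and> independent \<A> J}"
  have "\<exists>M\<in>\<X>. \<forall>J\<in>\<X>. M \<subseteq> J \<longrightarrow> J = M"
  proof (rule subset_Zorn_nonempty)
    show "\<X> \<noteq> {}" using assms unfolding \<X>_def by auto
    fix C assume C: "C \<noteq> {}" "subset.chain \<X> C"
    have CX: "C \<subseteq> \<X>" using C(2) unfolding subset.chain_def by blast
    have "x \<notin> generated \<A> (\<Union>C - {x})" if x: "x \<in> \<Union>C" for x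
    proof
      assume gx: "x \<in> generated \<A> (\<Union>C - {x})"
      \<comment> \<open>Removing \<open>x\<close> from every member leaves a chain, so the
        dependence of \<open>x\<close> already occurs inside one \<open>c - {x}\<close>. The larger
        of \<open>c\<close> and a member containing \<open>x\<close> is then not
        independent.\<close>
      have "subset.chain UNIV ((\<lambda>c. c - {x}) ` C)"
        using C(2) unfolding subset.chain_def by blast
      moreover have "(\<Union>c\<in>C. c - {x}) = \<Union>C - {x}" by blast
      ultimately obtain c where c: "c \<in> C" "x \<in> generated \<A> (c - {x})"
        using generated_chain_Union[of UNIV "(\<lambda>c. c - {x}) ` C" x \<A>] C(1) gx by auto
      obtain d where d: "d \<in> C" "x \<in> d" using x by blast
      have "c \<subseteq> d \<or> d \<subseteq> c" using C(2) c(1) d(1) unfolding subset.chain_def by blast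
      then obtain m where m: "m \<in> C" "c \<subseteq> m" "d \<subseteq> m" using c(1) d(1) by blast
      have "c - {x} \<subseteq> m - {x}" using m(2) by blast
      then have "x \<in> generated \<A> (m - {x})" using c(2) generated_mono by (metis subsetD)
      moreover have "independent \<A> m" using m(1) CX unfolding \<X>_def by blast
      ultimately show False using m(3) d(2) unfolding independent_def by blast
    qed
    moreover have "I \<subseteq> \<Union>C" "\<Union>C \<subseteq> S" using C(1) CX unfolding \<X>_def by blast+
    ultimately show "\<Union>C \<in> \<X>"
      using assms(4) unfolding \<X>_def independent_def by blast
  qed
  then obtain J where "J \<in> \<X>" and max: "\<And>K. K \<in> \<X> \<Longrightarrow> J \<subseteq> K \<Longrightarrow> K = J" by metis
  then have J: "I \<subseteq> J" "J \<subseteq> S" "independent \<A> J" unfolding \<X>_def by auto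
  have "x \<in> generated \<A> J" if x: "x \<in> S" for x
  proof (rule ccontr)
    assume nx: "x \<notin> generated \<A> J"
    then have "independent \<A> (insert x J)"
      using independent_insert[OF assms(1) J(3)] x assms(4) by blast
    then have "insert x J = J" using J x by (intro max) (auto simp: \<X>_def)
    then show False using nx generated_superset[of J \<A>] by blast
  qed
  then show thesis using that J by blast
qed

section \<open>Endomorphisms and their values on generating sets\<close>

lemma EndI:
  assumes "h \<in> universe \<A> \<rightarrow>\<^sub>E universe \<A>"
    and "\<And>f xs. \<lbrakk>(length xs, f) \<in> operations \<A>; set xs \<subseteq> universe \<A>\<rbrakk> \<Longrightarrow> h (f xs) = f (map h xs)"
  shows "h \<in> End \<A>"
  using assms unfolding End_def by blast

lemma End_funcset: "h \<in> End \<A> \<Longrightarrow> h \<in> universe \<A> \<rightarrow>\<^sub>E universe \<A>"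
  unfolding End_def by blast

lemma End_app:
  "\<lbrakk>h \<in> End \<A>; x \<in> universe \<A>\<rbrakk> \<Longrightarrow> h x \<in> universe \<A>"
  unfolding End_def by blast

lemma End_op:
  "\<lbrakk>h \<in> End \<A>; (n, f) \<in> operations \<A>; length xs = n; set xs \<subseteq> universe \<A>\<rbrakk>
    \<Longrightarrow> h (f xs) = f (map h xs)"
  unfolding End_def by blast

text \<open>The set on which two endomorphisms agree is closed under the operations.\<close>

lemma End_eq_on_generated:
  assumes "is_ualgebra \<A>" "h \<in> End \<A>" "k \<in> End \<A>" "X \<subseteq> universe \<A>"
    and "\<And>x. x \<in> X \<Longrightarrow> h x = k x" and "y \<in> generated \<A> X"
  shows "h y = k y"
proof -
  let ?E = "{x \<in> universe \<A>. h x = k x}"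
  have "closed_under_ops \<A> ?E"
    unfolding closed_under_ops_def
  proof clarify
    fix f and xs :: "'a list"
    assume f: "(length xs, f) \<in> operations \<A>" and xs: "set xs \<subseteq> ?E"
    then have xs': "set xs \<subseteq> universe \<A>" and "map h xs = map k xs" by auto
    then have "h (f xs) = k (f xs)"
      using End_op[OF assms(2) f refl xs'] End_op[OF assms(3) f refl xs'] by metis
    then show "f xs \<in> universe \<A> \<and> h (f xs) = k (f xs)"
      using f xs' assms(1) unfolding is_ualgebra_def by (auto intro: closed_under_opsD)
  qed
  then show ?thesis using generated_subset_closed[of X ?E \<A>] assms(4-6) by blast
qed

text \<open>The preimage of a closed set under an endomorphism is closed, so the inclusion of the
  image in \<open>B\<close> can be checked on a basis.\<close>

lemma End_generated_into:
  assumes "is_ualgebra \<A>" "h \<in> End \<A>" "X \<subseteq> universe \<A>" "closed_under_ops \<A> B"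
    and "h ` X \<subseteq> B" and "y \<in> generated \<A> X"
  shows "h y \<in> B"
proof -
  let ?E = "{x \<in> universe \<A>. h x \<in> B}"
  have "closed_under_ops \<A> ?E"
    unfolding closed_under_ops_def
  proof clarify
    fix f and xs :: "'a list"
    assume f: "(length xs, f) \<in> operations \<A>" and xs: "set xs \<subseteq> ?E"
    then have xs': "set xs \<subseteq> universe \<A>" "set (map h xs) \<subseteq> B" by auto
    then have "f (map h xs) \<in> B" by (intro closed_under_opsD[OF assms(4) f]) auto
    then show "f xs \<in> universe \<A> \<and> h (f xs) \<in> B"
      using f xs'(1) End_op[OF assms(2) f refl] assms(1)
      unfolding is_ualgebra_def by (auto intro: closed_under_opsD)
  qed
  then show ?thesis using generated_subset_closed[of X ?E \<A>] assms(3,5,6) by blast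
qed

lemma End_compose:
  assumes "is_ualgebra \<A>" "h \<in> End \<A>" "k \<in> End \<A>"
  shows "compose (universe \<A>) h k \<in> End \<A>"
proof -
  let ?U = "universe \<A>"
  have "compose ?U h k \<in> ?U \<rightarrow>\<^sub>E ?U"
    using End_app[OF assms(2)] End_app[OF assms(3)] by (auto simp: compose_def)
  moreover have "compose ?U h k (f xs) = f (map (compose ?U h k) xs)"
    if f: "(length xs, f) \<in> operations \<A>" and xs: "set xs \<subseteq> ?U" for f xs
  proof -
    have "f xs \<in> ?U" using f xs assms(1) unfolding is_ualgebra_def by (auto intro: closed_under_opsD)
    then have "compose ?U h k (f xs) = h (f (map k xs))"
      using End_op[OF assms(3) f refl xs] by (simp add: compose_eq)
    also have "\<dots> = f (map h (map k xs))"
      using xs f End_app[OF assms(3)] by (intro End_op[OF assms(2)]) auto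
    also have "map h (map k xs) = map (compose ?U h k) xs"
      using xs by (auto simp: compose_eq)
    finally show ?thesis .
  qed
  ultimately show ?thesis by (rule EndI)
qed

lemma End_id:
  assumes "is_ualgebra \<A>"
  shows "restrict id (universe \<A>) \<in> End \<A>"
proof -
  have "f xs \<in> universe \<A>"
    if "(length xs, f) \<in> operations \<A>" "set xs \<subseteq> universe \<A>" for f xs
    using that assms closed_under_opsD unfolding is_ualgebra_def by blast
  moreover have "map (restrict id (universe \<A>)) xs = xs" if "set xs \<subseteq> universe \<A>" for xs
    using that by (intro map_idI) auto
  ultimately show ?thesis by (intro EndI) auto
qed

section \<open>Isomorphism with an endomorphism monoid forces \<open>B\<close> to be everything or a
  singleton\<close>

lemma End_into_right_identity:
  assumes "is_ualgebra \<A>" "is_ualgebra \<C>" "End_into_iso_End \<A> B \<C>"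
  obtains e where "e \<in> End_into \<A> B"
    and "\<And>h. h \<in> End_into \<A> B \<Longrightarrow> compose (universe \<A>) h e = h"
proof -
  let ?i = "restrict id (universe \<C>)"
  obtain \<Phi> where bij: "bij_betw \<Phi> (End_into \<A> B) (End \<C>)"
    and hom: "\<And>h k. h \<in> End_into \<A> B \<Longrightarrow> k \<in> End_into \<A> B \<Longrightarrow>
      \<Phi> (compose (universe \<A>) h k) = compose (universe \<C>) (\<Phi> h) (\<Phi> k)"
    using assms(3) unfolding End_into_iso_End_def semigroup_isomorphic_def by blast
  \<comment> \<open>\<open>e\<close> is the preimage of the identity of \<open>\<C>\<close>;
    injectivity of \<open>\<Phi>\<close> will transfer the right identity law back.\<close>
  obtain e where e: "e \<in> End_into \<A> B" "\<Phi> e = ?i"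
    using End_id[OF assms(2)] bij unfolding bij_betw_def by (metis imageE)
  have "compose (universe \<A>) h e = h" if h: "h \<in> End_into \<A> B" for h
  proof -
    have "\<Phi> h \<in> universe \<C> \<rightarrow>\<^sub>E universe \<C>" using h bij End_funcset bij_betwE by blast
    \<comment> \<open>Both sides are \<open>undefined\<close> off the universe, so they are equal as
      functions.\<close>
    then have "compose (universe \<C>) (\<Phi> h) ?i = \<Phi> h"
      by (auto simp: compose_def fun_eq_iff PiE_def extensional_def)
    then have "\<Phi> (compose (universe \<A>) h e) = \<Phi> h" using hom[OF h e(1)] e(2) by simp
    moreover have "compose (universe \<A>) h e \<in> End_into \<A> B"
      using h e(1) End_compose[OF assms(1), of h e] End_app
      unfolding End_into_def by (fastforce simp: compose_eq)
    ultimately show ?thesis using h bij unfolding bij_betw_def inj_on_def by blast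
  qed
  then show thesis using that e(1) by blast
qed

lemma End_into_monoid_imp:
  assumes "independence_algebra \<A>" "subuniverse \<A> B" "B \<noteq> {}"
    and e: "e \<in> End_into \<A> B" "\<And>h. h \<in> End_into \<A> B \<Longrightarrow> compose (universe \<A>) h e = h"
  shows "B = universe \<A> \<or> is_singleton B"
proof (rule ccontr)
  assume neg: "\<not> (B = universe \<A> \<or> is_singleton B)"
  let ?U = "universe \<A>"
  have ua: "is_ualgebra \<A>" and ep: "exchange_property \<A>" and fb: "free_basis_property \<A>"
    using assms(1) unfolding independence_algebra_def by auto
  have BU: "B \<subseteq> ?U" and Bcl: "closed_under_ops \<A> B"
    using assms(2) unfolding subuniverse_def by auto
  obtain x where x: "x \<in> ?U" "x \<notin> B" using neg BU by blast
  obtain b where b: "b \<in> B" using assms(3) by blast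
  then obtain c where c: "c \<in> B" "c \<noteq> b" using neg by (auto simp: is_singleton_def)
  have "independent \<A> {}" unfolding independent_def by simp
  \<comment> \<open>A basis of \<open>B\<close>, obtained by extending the empty set.\<close>
  then obtain Y where Y: "Y \<subseteq> B" "independent \<A> Y" "B \<subseteq> generated \<A> Y"
    using independent_extend[OF ep _ empty_subsetI BU] by metis
  have "x \<notin> generated \<A> Y" using x(2) generated_subset_closed[OF Y(1) Bcl] by blast
  then have "independent \<A> (insert x Y)" using independent_insert[OF ep Y(2) x(1)] by blast
  moreover have "insert x Y \<subseteq> ?U" using x(1) Y(1) BU by blast
  ultimately obtain X where X: "insert x Y \<subseteq> X" "X \<subseteq> ?U" "independent \<A> X" "?U \<subseteq> generated \<A> X"
    using independent_extend[OF ep] by blast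
  have "generated \<A> X \<subseteq> ?U"
    using generated_subset_closed[OF X(2)] ua unfolding is_ualgebra_def by blast
  then have basis: "basis_of \<A> ?U X" using X(3,4) unfolding basis_of_def by blast
  \<comment> \<open>Freeness on the basis \<open>X\<close> allows any value \<open>d\<close> of
    \<open>B\<close> at \<open>x\<close> while every other basis element goes to \<open>b\<close>.
    As \<open>X\<close> is sent into \<open>B\<close> and generates the universe, the whole image
    lies in \<open>B\<close>.\<close>
  have ex: "\<exists>h. h \<in> End_into \<A> B \<and> (\<forall>y\<in>X. h y = (if y = x then d else b))"
    if d: "d \<in> B" for d
  proof -
    have "(\<lambda>y. if y = x then d else b) \<in> X \<rightarrow> ?U" using b d BU by auto
    then obtain h where h: "h \<in> End \<A>" "\<forall>y\<in>X. h y = (if y = x then d else b)"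
      using fb basis unfolding free_basis_property_def by blast
    have "h ` X \<subseteq> B" using h(2) b d by auto
    then have "h ` ?U \<subseteq> B" using End_generated_into[OF ua h(1) X(2) Bcl] X(4) by blast
    then show ?thesis using h unfolding End_into_def by blast
  qed
  \<comment> \<open>The choice \<open>d = b\<close>, which makes \<open>h\<close> constant on
    \<open>X\<close>; \<open>k\<close> below takes \<open>d = c\<close>, so the two differ on
    \<open>X\<close> only at \<open>x\<close>.\<close>
  obtain h where h: "h \<in> End_into \<A> B" "\<forall>y\<in>X. h y = (if y = x then b else b)"
    using ex[OF b] by blast
  obtain k where k: "k \<in> End_into \<A> B" "\<forall>y\<in>X. k y = (if y = x then c else b)"
    using ex[OF c(1)] by blast
  have "h y = k y" if "y \<in> Y" for y
  proof -
    have "y \<in> X" "y \<noteq> x" using that X(1) x(2) Y(1) by auto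
    then show ?thesis using h(2) k(2) by simp
  qed
  moreover have "Y \<subseteq> ?U" using Y(1) BU by blast
  moreover have "e x \<in> generated \<A> Y" using e(1) x(1) Y(3) unfolding End_into_def by blast
  moreover have "h \<in> End \<A>" "k \<in> End \<A>" using h(1) k(1) unfolding End_into_def by auto
  ultimately have "h (e x) = k (e x)" using End_eq_on_generated[OF ua] by metis
  then have "h x = k x" using e(2)[OF h(1)] e(2)[OF k(1)] x(1) by (metis compose_eq)
  then show False using h(2) k(2) X(1) c(2) by auto
qed

section \<open>Constructing \<open>\<C>\<close> in the two remaining cases\<close>

lemma semigroup_isomorphic_refl: "semigroup_isomorphic S m S m"
  unfolding semigroup_isomorphic_def by (rule exI[of _ id]) auto

text \<open>With one point the two elements in the exchange property coincide, and the identity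
  extends every map from a subset of \<open>{b}\<close> to \<open>{b}\<close>.\<close>

lemma independence_algebra_singleton:
  "independence_algebra \<lparr>universe = {b}, operations = {}\<rparr>" (is "independence_algebra ?C")
proof -
  have ua: "is_ualgebra ?C" unfolding is_ualgebra_def closed_under_ops_def by auto
  moreover have "exchange_property ?C"
    unfolding exchange_property_def by auto
  moreover have "free_basis_property ?C"
    unfolding free_basis_property_def
  proof (intro allI impI)
    fix X and \<phi> :: "'a \<Rightarrow> 'a"
    assume *: "basis_of ?C (universe ?C) X \<and> \<phi> \<in> X \<rightarrow> universe ?C"
    then have "X \<subseteq> {b}" unfolding basis_of_def independent_def by simp
    then have "\<forall>x\<in>X. restrict id {b} x = \<phi> x" using * by auto
    moreover have "restrict id {b} \<in> End ?C" using End_id[OF ua] by simp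
    ultimately show "\<exists>h\<in>End ?C. \<forall>x\<in>X. h x = \<phi> x" by blast
  qed
  ultimately show ?thesis unfolding independence_algebra_def by blast
qed

lemma End_into_singleton:
  assumes "is_ualgebra \<A>" "subuniverse \<A> {b}"
  shows "End_into \<A> {b} = {\<lambda>x\<in>universe \<A>. b}" (is "_ = {?k}")
proof
  have "h = ?k" if "h \<in> End_into \<A> {b}" for h
    using that End_funcset[of h \<A>] unfolding End_into_def
    by (auto simp: fun_eq_iff PiE_def extensional_def)
  then show "End_into \<A> {b} \<subseteq> {?k}" by blast
next
  have bU: "b \<in> universe \<A>" and cl: "closed_under_ops \<A> {b}"
    using assms(2) unfolding subuniverse_def by auto
  have "?k (f xs) = f (map ?k xs)"
    if f: "(length xs, f) \<in> operations \<A>" and xs: "set xs \<subseteq> universe \<A>" for f xs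
  proof -
    have "f xs \<in> universe \<A>"
      using f xs assms(1) unfolding is_ualgebra_def by (auto intro: closed_under_opsD)
    \<comment> \<open>The constant map respects \<open>f\<close> because the closed set
      \<open>{b}\<close> forces \<open>f\<close> to return \<open>b\<close> on lists of
      \<open>b\<close>'s; this includes nullary \<open>f\<close>.\<close>
    moreover have "f (map ?k xs) \<in> {b}" using f xs by (intro closed_under_opsD[OF cl f]) auto
    ultimately show ?thesis by simp
  qed
  then have "?k \<in> End \<A>" using bU by (intro EndI) auto
  then show "{?k} \<subseteq> End_into \<A> {b}" unfolding End_into_def by auto
qed

text \<open>Both semigroups consist of a single idempotent. For the right-hand one,
  \<open>End_into_singleton\<close> is applied to the one-point algebra with itself as
  target.\<close>

lemma End_into_iso_End_singleton:
  assumes "is_ualgebra \<A>" "subuniverse \<A> {b}"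
  shows "End_into_iso_End \<A> {b} \<lparr>universe = {c}, operations = {}\<rparr>"
proof -
  let ?C = "\<lparr>universe = {c}, operations = {}\<rparr>"
  let ?k = "\<lambda>x\<in>universe \<A>. b" and ?i = "\<lambda>x\<in>{c}. c"
  have "End ?C = End_into ?C {c}" unfolding End_into_def using End_app[of _ ?C] by auto
  also have "\<dots> = {?i}"
    using End_into_singleton[of ?C c] independence_algebra_singleton[of c]
    by (simp add: independence_algebra_def subuniverse_def closed_under_ops_def)
  finally have "End ?C = {?i}" .
  moreover have "compose {c} ?i ?i = ?i" by (auto simp: compose_def)
  ultimately show ?thesis
    using End_into_singleton[OF assms]
    unfolding End_into_iso_End_def semigroup_isomorphic_def
    by (intro exI[of _ "\<lambda>_. ?i"]) (auto simp: bij_betw_def)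
qed

text \<open>The quantifier over \<open>\<C>\<close> is bound to one type. For sufficiency the type
  of \<open>\<A>\<close> is enough, since the witness is \<open>\<A>\<close> or a one-point algebra
  on an element of \<open>B\<close>; the second conjunct states necessity for \<open>\<C>\<close>
  over an arbitrary type.\<close>

theorem corollary2p2:
  fixes \<A> :: "'a ualgebra" and B :: "'a set"
  assumes "independence_algebra \<A>"
    and "subuniverse \<A> B"
    and "B \<noteq> {}"
  shows "((\<exists>\<C> :: 'a ualgebra. independence_algebra \<C> \<and> End_into_iso_End \<A> B \<C>)
            \<longleftrightarrow> B = universe \<A> \<or> is_singleton B)
       \<and> ((\<exists>\<C> :: 'c ualgebra. independence_algebra \<C> \<and> End_into_iso_End \<A> B \<C>)
            \<longrightarrow> B = universe \<A> \<or> is_singleton B)"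
proof (intro conjI iffI impI)
  have ua: "is_ualgebra \<A>" using assms(1) unfolding independence_algebra_def by blast
  note right_identity = End_into_right_identity[OF ua] End_into_monoid_imp[OF assms]
  show "B = universe \<A> \<or> is_singleton B"
    if "\<exists>\<C> :: 'a ualgebra. independence_algebra \<C> \<and> End_into_iso_End \<A> B \<C>"
    using that right_identity unfolding independence_algebra_def by metis
  show "B = universe \<A> \<or> is_singleton B"
    if "\<exists>\<C> :: 'c ualgebra. independence_algebra \<C> \<and> End_into_iso_End \<A> B \<C>"
    using that right_identity unfolding independence_algebra_def by metis
  show "\<exists>\<C> :: 'a ualgebra. independence_algebra \<C> \<and> End_into_iso_End \<A> B \<C>"
    if "B = universe \<A> \<or> is_singleton B"
    using that
  proof
    assume "B = universe \<A>"
    then have "End_into \<A> B = End \<A>" unfolding End_into_def by (auto intro: End_app)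
    then have "End_into_iso_End \<A> B \<A>"
      unfolding End_into_iso_End_def by (simp add: semigroup_isomorphic_refl)
    then show ?thesis using assms(1) by blast
  next
    assume "is_singleton B"
    then obtain b where "B = {b}" by (auto simp: is_singleton_def)
    then have "End_into_iso_End \<A> B \<lparr>universe = {b}, operations = {}\<rparr>"
      using End_into_iso_End_singleton[OF ua] assms(2) by simp
    then show ?thesis using independence_algebra_singleton by metis
  qed
qed

end
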